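(* Let $X$ be a rooted tree on $n$ nodes with binary labels, such that for each level $\ell$ all nodes on level $\ell$ have the same number $k_\ell$ of children. Let $k_{\max} := \max_\ell k_\ell$ and $k_{\min} := \min_\ell k_\ell$, where the minimum is over all levels except the last one (containing the leaves). If $q < \frac{c}{c+1}$ and $k_{\min} > c$ for some $c \in \mathbb{Z}^+$, then there exists a finite constant $C$, depending only on $c$ and $q$, such that in the TED deletion model with deletion probability $q$, $\exp(C k_{\max}\log_{k_{\min}} n)$ independent traces suffice to reconstruct the labels of $X$ with high probability (i.e., there is an estimator which, given the topology, $q$ and that many traces, outputs the labels of $X$ with probability tending to $1$ as $n\to\infty$).
   Context: Tree trace reconstruction: $X$ is a rooted tree of known topology whose non-root nodes carry unknown binary labels; the children of every node have a left-to-right order. The level of a node is its graph distance from the root. TED (Tree Edit Distance) deletion model with parameter $q$: each non-root node is deleted independently with probability $q$ (the root is never deleted); deletions are associative, and when a node $v$ is deleted, all of its children become children of the parent of $v$ (contracting the edge between $v$ and its parent, keeping the parent's label), taking the place of $v$ in the left-to-right order among the parent's children. The resulting labeled ordered rooted tree is a trace. The goal is to recover the labels of $X$ from independent traces, knowing the deletion model, $q$, and the topology of $X$. *)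

theory Defs
  imports "HOL-Probability.Probability"
begin

text \<open>Finite ordered rooted trees; every node except the root carries a label.\<close>

datatype 'a node = Node (label: 'a) (subs: "'a node list")

datatype 'a rtree = Root (kids: "'a node list")

text \<open>
  A node is addressed by the list of child positions (counted from 0, left to right) on the path
  from the root to it. The root has address \<open>[]\<close>, and the level of a node is the length of its
  address.
\<close>

fun children_at :: "'a node list \<Rightarrow> nat list \<Rightarrow> 'a node list option" where
  "children_at ts [] = Some ts"
| "children_at ts (i # v) = (if i < length ts then children_at (subs (ts ! i)) v else None)"

definition nodes :: "'a rtree \<Rightarrow> nat list set" where
  "nodes X = {v. children_at (kids X) v \<noteq> None}"

definition num_children :: "'a rtree \<Rightarrow> nat list \<Rightarrow> nat" where
  "num_children X v = length (the (children_at (kids X) v))"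

definition last_level :: "'a rtree \<Rightarrow> nat" where
  "last_level X = Max (length ` nodes X)"

definition level_regular :: "'a rtree \<Rightarrow> (nat \<Rightarrow> nat) \<Rightarrow> bool" where
  "level_regular X k \<longleftrightarrow> (\<forall>v\<in>nodes X. num_children X v = k (length v))"

definition k_max :: "'a rtree \<Rightarrow> (nat \<Rightarrow> nat) \<Rightarrow> nat" where
  "k_max X k = Max (k ` {..last_level X})"

definition k_min :: "'a rtree \<Rightarrow> (nat \<Rightarrow> nat) \<Rightarrow> nat" where
  "k_min X k = Min (k ` {..<last_level X})"

definition tree_topology :: "'a rtree \<Rightarrow> unit rtree" where
  "tree_topology X = map_rtree (\<lambda>_. ()) X"

text \<open>
  \<open>D v\<close> says that the node with address \<open>v\<close> (in the original tree) is deleted.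
  \<open>contract_node D v t\<close> is the ordered list of trees that takes the place of the subtree \<open>t\<close> at
  address \<open>v\<close> in the child list of its parent, after all deletions within that subtree.
  In \<open>contract_kids D v i ts\<close> the list \<open>ts\<close> consists of the children of \<open>v\<close> from position \<open>i\<close> on.
\<close>

fun contract_node :: "(nat list \<Rightarrow> bool) \<Rightarrow> nat list \<Rightarrow> 'a node \<Rightarrow> 'a node list"
  and contract_kids :: "(nat list \<Rightarrow> bool) \<Rightarrow> nat list \<Rightarrow> nat \<Rightarrow> 'a node list \<Rightarrow> 'a node list"
where
  "contract_node D v (Node a ts) =
     (if D v then contract_kids D v 0 ts else [Node a (contract_kids D v 0 ts)])"
| "contract_kids D v i [] = []"
| "contract_kids D v i (t # ts) = contract_node D (v @ [i]) t @ contract_kids D v (Suc i) ts"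

definition ted_delete :: "(nat list \<Rightarrow> bool) \<Rightarrow> 'a rtree \<Rightarrow> 'a rtree" where
  "ted_delete D X = Root (contract_kids D [] 0 (kids X))"

definition ted_trace :: "real \<Rightarrow> 'a rtree \<Rightarrow> 'a rtree pmf" where
  "ted_trace q X =
     map_pmf (\<lambda>D. ted_delete D X) (Pi_pmf (nodes X - {[]}) False (\<lambda>_. bernoulli_pmf q))"

definition ted_traces :: "real \<Rightarrow> nat \<Rightarrow> 'a rtree \<Rightarrow> 'a rtree list pmf" where
  "ted_traces q T X = replicate_pmf T (ted_trace q X)"

text \<open>Finiteness matters: \<open>card\<close>, \<open>Max\<close> and \<open>Pi_pmf\<close> above are meaningful only for finite sets.\<close>

lemma finite_children_at: "finite {v. children_at ts v \<noteq> None}"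
proof (induction "size_list size ts" arbitrary: ts rule: less_induct)
  case less
  have "{v. children_at ts v \<noteq> None} \<subseteq>
    insert [] (\<Union>i<length ts. (#) i ` {v. children_at (subs (ts ! i)) v \<noteq> None})"
  proof
    fix v assume "v \<in> {v. children_at ts v \<noteq> None}"
    then show "v \<in> insert [] (\<Union>i<length ts. (#) i ` {v. children_at (subs (ts ! i)) v \<noteq> None})"
      by (cases v) (auto split: if_splits)
  qed
  moreover have "finite {v. children_at (subs (ts ! i)) v \<noteq> None}" if "i < length ts" for i
  proof (rule less)
    have "size_list size (subs (ts ! i)) < size (ts ! i)" by (cases "ts ! i") simp
    also have "\<dots> \<le> size_list size ts" using that by (intro size_list_estimation'[of "ts ! i"]) auto
    finally show "size_list size (subs (ts ! i)) < size_list size ts" .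
  qed
  ultimately show ?case by (elim finite_subset) auto
qed

lemma finite_nodes: "finite (nodes X)"
  unfolding nodes_def by (rule finite_children_at)

end

theory Submission
  imports Defs
begin

text \<open>
  Let \<open>d\<close> be the last level. Contraction never increases heights, so a child of the root of a
  trace that starts a downward path of \<open>d\<close> nodes must be an undeleted node of level 1 of the original
  tree. If the root of the trace has \<open>k\<^sub>0\<close> such children, then they are all the nodes of level 1, in
  their original order, and one can descend into any of them in the same way. Hence a trace in which
  this succeeds along the address \<open>v\<close> reveals the label of \<open>v\<close> without error.
  Since \<open>(1 - q) (c + 1) > 1\<close>, the surviving descendants form a supercritical branching process: a node
  survives together with some path to the last level with probability at least a constant
  \<open>\<gamma> > 0\<close>. So a trace reveals the label of \<open>v\<close> with probability at least
  \<open>\<gamma> ^ (1 + k\<^sub>0 + \<dots> + k\<^bsub>d-1\<^esub>) \<ge> exp (- O(k\<^sub>m\<^sub>a\<^sub>x d))\<close>, where \<open>d \<le> log\<^bsub>kmin\<^esub> n\<close>, and a union bound over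
  the addresses concludes. The estimator returns any tree that is consistent with all traces.
\<close>

section \<open>Regular forests, addresses, and reading a label from a trace\<close>

fun regular_forest :: "nat list \<Rightarrow> 'a node list \<Rightarrow> bool" where
  "regular_forest [] ts \<longleftrightarrow> ts = []"
| "regular_forest (k # ks) ts \<longleftrightarrow> length ts = k \<and> (\<forall>t\<in>set ts. regular_forest ks (subs t))"

fun address :: "nat list \<Rightarrow> nat list \<Rightarrow> bool" where
  "address ks [] \<longleftrightarrow> True"
| "address [] (i # v) \<longleftrightarrow> False"
| "address (k # ks) (i # v) \<longleftrightarrow> i < k \<and> address ks v"

fun label_at :: "'a node list \<Rightarrow> nat list \<Rightarrow> 'a option" where
  "label_at ts [] = None"
| "label_at ts (i # v) =
     (if i < length ts
      then if v = [] then Some (label (ts ! i)) else label_at (subs (ts ! i)) v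
      else None)"

text \<open>Here \<open>h\<close> counts edges, so the path has \<open>h + 1\<close> nodes. A top
  node of a forest with child counts \<open>k # ks\<close> has \<open>length ks\<close> further
  levels below it.\<close>

primrec reaches :: "nat \<Rightarrow> 'a node \<Rightarrow> bool" where
  "reaches 0 t \<longleftrightarrow> True"
| "reaches (Suc h) t \<longleftrightarrow> (\<exists>s\<in>set (subs t). reaches h s)"

text \<open>\<open>length ks\<close> is the depth that a genuine top node can attain below itself.
  The count \<open>k\<close> acts as a certificate: if it is missed, some original node may be
  absent, positions are unreliable, and the trace is declared inconclusive by
  \<open>None\<close>.\<close>

fun read_label :: "nat list \<Rightarrow> nat list \<Rightarrow> 'a node list \<Rightarrow> 'a option" where
  "read_label (k # ks) (i # v) ts =
     (let fs = filter (reaches (length ks)) ts in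
      if length fs = k \<and> i < k
      then if v = [] then Some (label (fs ! i)) else read_label ks v (subs (fs ! i))
      else None)"
| "read_label _ _ _ = None"

lemma children_at_iff_address:
  "regular_forest ks ts \<Longrightarrow> children_at ts v \<noteq> None \<longleftrightarrow> address ks v"
proof (induction ks v arbitrary: ts rule: address.induct)
  case (3 k ks i v)
  then show ?case by (auto simp: all_set_conv_all_nth)
qed auto

lemma regular_forest_map:
  "regular_forest ks (map (map_node f) ts) \<longleftrightarrow> regular_forest ks ts"
proof (induction ks arbitrary: ts)
  case (Cons k ks)
  have "subs (map_node f t) = map (map_node f) (subs t)" for t by (cases t) auto
  then show ?case using Cons by auto
qed auto

text \<open>The list \<open>ks\<close> fixes the shape completely, so labels are the only freedom
  left. This reduces reconstruction to one label per nonempty address.\<close>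

lemma regular_forest_eqI:
  assumes "regular_forest ks ts" "regular_forest ks us"
    and "\<And>v. v \<noteq> [] \<Longrightarrow> address ks v \<Longrightarrow> label_at ts v = label_at us v"
  shows "ts = us"
  using assms
proof (induction ks arbitrary: ts us)
  case (Cons k ks)
  have "ts ! i = us ! i" if i: "i < k" for i
  proof -
    have "label_at ts [i] = label_at us [i]" using i Cons.prems(3)[of "[i]"] by simp
    then have "label (ts ! i) = label (us ! i)" using Cons.prems i by simp
    moreover have "subs (ts ! i) = subs (us ! i)"
    proof (rule Cons.IH)
      show "regular_forest ks (subs (ts ! i))" "regular_forest ks (subs (us ! i))"
        using Cons.prems i by auto
      show "label_at (subs (ts ! i)) v = label_at (subs (us ! i)) v"
        if "v \<noteq> []" "address ks v" for v
        using Cons.prems(3)[of "i # v"] Cons.prems(1,2) that i by simp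
    qed
    ultimately show ?thesis by (metis node.expand)
  qed
  then show ?case using Cons.prems by (auto intro: nth_equalityI)
qed auto

text \<open>The offset \<open>l\<close> is the level of the node whose children form
  \<open>ts\<close>; it is there for the induction on \<open>d - l\<close>. That nothing hangs below
  level \<open>d\<close> comes from the height bound.\<close>

lemma regular_forest_of_levels:
  assumes "\<And>v us. children_at ts v = Some us \<Longrightarrow> length us = k (l + length v)"
    and "\<And>v. children_at ts v \<noteq> None \<Longrightarrow> l + length v \<le> d"
  shows "regular_forest (map k [l..<d]) ts"
  using assms
proof (induction "d - l" arbitrary: l ts)
  case 0
  have "children_at ts [] \<noteq> None" by simp
  then have "l = d" using 0(1) 0(3)[of "[]"] by auto
  then have "ts = []" using 0(3)[of "[0]"] by (cases ts) auto
  then show ?case using \<open>l = d\<close> by simp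
next
  case (Suc m)
  have "length ts = k l" using Suc.prems(1)[of "[]"] by simp
  moreover have "regular_forest (map k [Suc l..<d]) (subs t)" if "t \<in> set ts" for t
  proof -
    obtain i where i: "i < length ts" "t = ts ! i" using \<open>t \<in> set ts\<close> by (auto simp: in_set_conv_nth)
    show ?thesis
    proof (rule Suc.hyps)
      show "m = d - Suc l" using Suc.hyps(2) by simp
      show "length us = k (Suc l + length v)" if "children_at (subs t) v = Some us" for v us
        using Suc.prems(1)[of "i # v" us] that i by simp
      show "Suc l + length v \<le> d" if "children_at (subs t) v \<noteq> None" for v
        using Suc.prems(2)[of "i # v"] that i by simp
    qed
  qed
  moreover have "[l..<d] = l # [Suc l..<d]" using Suc.hyps(2) by (simp add: upt_conv_Cons)
  ultimately show ?case by simp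
qed

text \<open>Splitting addresses by their first entry gives \<open>k\<close> disjoint families. The
  empty address is dropped at each level above the last, so in effect only the last level is
  counted.\<close>

lemma card_children_at_ge:
  "regular_forest ks ts \<Longrightarrow> prod_list ks \<le> card {v. children_at ts v \<noteq> None}"
proof (induction ks arbitrary: ts)
  case Nil
  have "{v. children_at ts v \<noteq> None} \<noteq> {}" by (auto intro: exI[of _ "[]"])
  then show ?case using finite_children_at[of ts] by (simp add: card_gt_0_iff Suc_le_eq)
next
  case (Cons k ks)
  let ?N = "\<lambda>i. {v. children_at (subs (ts ! i)) v \<noteq> None}"
  have "prod_list (k # ks) = (\<Sum>i<k. prod_list ks)" by simp
  also have "\<dots> \<le> (\<Sum>i<k. card ((#) i ` ?N i))"
    using Cons by (intro sum_mono) (auto simp: card_image)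
  also have "\<dots> = card (\<Union>i<k. (#) i ` ?N i)"
    by (rule card_UN_disjoint[symmetric]) (use finite_children_at in blast)+
  also have "\<dots> \<le> card {v. children_at ts v \<noteq> None}"
    using Cons.prems by (intro card_mono finite_children_at) auto
  finally show ?case .
qed

section \<open>Contraction, and why a successful reading is never wrong\<close>

lemma contract_node_eq:
  "contract_node D u t =
     (if D u then contract_kids D u 0 (subs t)
      else [Node (label t) (contract_kids D u 0 (subs t))])"
  by (cases t) simp

lemma contract_kids_eq_concat:
  "contract_kids D u i ts =
     concat (map (\<lambda>j. contract_node D (u @ [i + j]) (ts ! j)) [0..<length ts])"
proof (induction ts arbitrary: i)
  case (Cons t ts)
  have "[0..<length (t # ts)] = 0 # map Suc [0..<length ts]"
    by (simp only: map_Suc_upt list.size upt_conv_Cons) simp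
  then show ?case by (simp add: Cons comp_def del: upt_Suc)
qed simp

lemma reaches_SucD: "reaches (Suc h) t \<Longrightarrow> reaches h t"
  by (induction h arbitrary: t) auto

text \<open>Contraction only shortens downward paths: a forest with \<open>length ks\<close> levels
  leaves no path with more than \<open>length ks\<close> nodes, whereas reaching
  \<open>length ks\<close> takes one node more.\<close>

lemma not_reaches_contract_kids:
  assumes "regular_forest ks ts" "s \<in> set (contract_kids D u i ts)"
  shows "\<not> reaches (length ks) s"
  using assms
proof (induction ks arbitrary: ts u i s)
  case (Cons k ks)
  obtain j where j: "j < length ts" "s \<in> set (contract_node D (u @ [i + j]) (ts ! j))"
    using Cons.prems(2) by (auto simp: contract_kids_eq_concat)
  have reg: "regular_forest ks (subs (ts ! j))" using Cons.prems j by auto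
  show ?case
  proof (cases "D (u @ [i + j])")
    case True
    then show ?thesis using Cons.IH[OF reg] j reaches_SucD by (fastforce simp: contract_node_eq)
  next
    case False
    then show ?thesis using Cons.IH[OF reg] j by (auto simp: contract_node_eq)
  qed
qed auto

text \<open>If top node \<open>j\<close> is deleted, whatever replaces it comes from a forest with
  only \<open>length ks\<close> levels and is too shallow for the filter. So only undeleted top
  nodes pass, in their original order.\<close>

lemma filter_reaches_contract_kids:
  fixes D u
  assumes "regular_forest (k # ks) ts"
  defines "f \<equiv> \<lambda>j. Node (label (ts ! j)) (contract_kids D (u @ [j]) 0 (subs (ts ! j)))"
  shows "filter (reaches (length ks)) (contract_kids D u 0 ts) =
    map f (filter (\<lambda>j. \<not> D (u @ [j]) \<and> reaches (length ks) (f j)) [0..<k])"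
proof -
  have "filter (reaches (length ks)) (contract_node D (u @ [j]) (ts ! j)) =
      (if \<not> D (u @ [j]) \<and> reaches (length ks) (f j) then [f j] else [])" if "j < k" for j
  proof -
    have "regular_forest ks (subs (ts ! j))" using assms(1) that by auto
    then show ?thesis using not_reaches_contract_kids[of ks "subs (ts ! j)"]
      by (auto simp: contract_node_eq f_def filter_empty_conv)
  qed
  then have "map (\<lambda>j. filter (reaches (length ks)) (contract_node D (u @ [j]) (ts ! j))) [0..<k] =
      map (\<lambda>j. if \<not> D (u @ [j]) \<and> reaches (length ks) (f j) then [f j] else []) [0..<k]"
    by (intro map_cong) auto
  moreover have "length ts = k" using assms(1) by simp
  moreover have "concat (map (\<lambda>j. if P j then [f j] else []) js) = map f (filter P js)" for P js
    by (induction js) auto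
  ultimately show ?thesis
    by (simp add: contract_kids_eq_concat filter_concat comp_def del: map_eq_conv)
qed

text \<open>A sublist of \<open>[0..<k]\<close> with \<open>k\<close> entries is the whole list, so
  the count alone certifies that position in the filtered list equals original position.\<close>

lemma filter_reaches_contract_kids_full:
  assumes "regular_forest (k # ks) ts"
    and "length (filter (reaches (length ks)) (contract_kids D u 0 ts)) = k"
  shows "filter (reaches (length ks)) (contract_kids D u 0 ts) =
    map (\<lambda>j. Node (label (ts ! j)) (contract_kids D (u @ [j]) 0 (subs (ts ! j)))) [0..<k]"
proof -
  have full: "filter P [0..<k] = [0..<k]" if "length (filter P [0..<k]) = k" for P
    by (metis that filter_True length_filter_less length_upt minus_nat.diff_0 nat_neq_iff)
  show ?thesis
    using full[OF assms(2)[unfolded filter_reaches_contract_kids[OF assms(1)] length_map]]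
    unfolding filter_reaches_contract_kids[OF assms(1)] by (simp only:)
qed

text \<open>The deletion pattern \<open>D\<close> is arbitrary: soundness is deterministic, and
  randomness matters only for whether a reading succeeds. The base address \<open>u\<close> varies
  so that the induction can descend.\<close>

lemma read_label_sound:
  assumes "regular_forest ks ts" "read_label ks v (contract_kids D u 0 ts) = Some a"
  shows "label_at ts v = Some a"
  using assms
proof (induction ks v "contract_kids D u 0 ts" arbitrary: ts u rule: read_label.induct)
  case (1 k ks i v)
  let ?fs = "filter (reaches (length ks)) (contract_kids D u 0 ts)"
  have *: "length ?fs = k" "i < k" using 1(3) by (auto simp: Let_def split: if_splits)
  have fs: "?fs ! i = Node (label (ts ! i)) (contract_kids D (u @ [i]) 0 (subs (ts ! i)))"
    using filter_reaches_contract_kids_full[OF 1(2) *(1)] *(2) by simp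
  have reg: "length ts = k" "regular_forest ks (subs (ts ! i))" using 1(2) *(2) by auto
  show ?case
  proof (cases "v = []")
    case True
    then show ?thesis using 1(3) * fs reg by (simp add: Let_def)
  next
    case False
    have "read_label ks v (subs (?fs ! i)) = Some a" using 1(3) * False by (simp add: Let_def)
    then have "label_at (subs (ts ! i)) v = Some a"
      using 1(1)[OF refl _ False _ reg(2), of "u @ [i]"] * fs by simp
    then show ?thesis using False reg * by simp
  qed
qed auto

section \<open>Survival events that make a reading succeed\<close>

fun alive :: "(nat list \<Rightarrow> bool) \<Rightarrow> nat list \<Rightarrow> nat list \<Rightarrow> bool" where
  "alive D [] u \<longleftrightarrow> \<not> D u"
| "alive D (k # ks) u \<longleftrightarrow> \<not> D u \<and> (\<exists>i<k. alive D ks (u @ [i]))"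

text \<open>Nodes on the path before its end are only required to be undeleted; \<open>alive\<close>
  is demanded of their siblings and of the end point. The conditions thus concern disjoint sets of
  nodes, so their probabilities multiply. The path nodes are alive anyway, because the path
  continues to an alive node.\<close>

fun visible :: "(nat list \<Rightarrow> bool) \<Rightarrow> nat list \<Rightarrow> nat list \<Rightarrow> nat list \<Rightarrow> bool" where
  "visible D (k # ks) u (i # v) \<longleftrightarrow>
     \<not> D u \<and> (\<forall>j\<in>{..<k} - {i}. alive D ks (u @ [j])) \<and> visible D ks (u @ [i]) v"
| "visible D ks u v \<longleftrightarrow> alive D ks u"

lemma alive_imp_not_deleted: "alive D ks u \<Longrightarrow> \<not> D u"
  by (cases ks) auto

lemma visible_imp_alive: "visible D ks u v \<Longrightarrow> address ks v \<Longrightarrow> alive D ks u"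
  by (induction D ks u v rule: visible.induct) auto

lemma alive_imp_reaches:
  assumes "regular_forest ks ts" "alive D ks u"
  shows "reaches (length ks) (Node a (contract_kids D u 0 ts))"
  using assms
proof (induction ks arbitrary: ts u a)
  case (Cons k ks)
  obtain i where i: "i < k" "alive D ks (u @ [i])" using Cons.prems by auto
  let ?s = "Node (label (ts ! i)) (contract_kids D (u @ [i]) 0 (subs (ts ! i)))"
  have "reaches (length ks) ?s" using Cons.prems i by (intro Cons.IH) auto
  moreover have "?s \<in> set (contract_kids D u 0 ts)"
    using Cons.prems i alive_imp_not_deleted[OF i(2)]
    by (auto simp: contract_kids_eq_concat[of D u] contract_node_eq intro!: bexI[of _ i])
  ultimately show ?case by auto
qed auto

text \<open>At every level of the path all \<open>k\<close> children are alive and hence pass the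
  depth filter, so each count test of \<open>read_label\<close> succeeds.\<close>

lemma visible_imp_read_label:
  assumes "regular_forest ks ts" "visible D ks u v" "address ks v" "v \<noteq> []"
  shows "read_label ks v (contract_kids D u 0 ts) \<noteq> None"
  using assms
proof (induction D ks u v arbitrary: ts rule: visible.induct)
  case (1 D k ks u i v)
  let ?fs = "filter (reaches (length ks)) (contract_kids D u 0 ts)"
  have vis: "visible D ks (u @ [i]) v" and i: "i < k" "address ks v" using 1 by auto
  \<comment> \<open>For siblings this is part of \<open>visible\<close>; for the path node itself it
    is inherited from the rest of the path.\<close>
  have alive: "alive D ks (u @ [j])" if "j < k" for j
    using 1(3) visible_imp_alive[OF vis i(2)] that by (cases "j = i") auto
  have reg: "regular_forest ks (subs (ts ! j))" if "j < k" for j using 1(2) that by auto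
  have "length ?fs = k"
    unfolding filter_reaches_contract_kids[OF 1(2)] length_map
    using alive alive_imp_not_deleted[OF alive] alive_imp_reaches[OF reg alive]
    by (subst filter_True) auto
  moreover from filter_reaches_contract_kids_full[OF 1(2) this]
  have "?fs ! i = Node (label (ts ! i)) (contract_kids D (u @ [i]) 0 (subs (ts ! i)))"
    using i by simp
  ultimately show ?case using 1(1)[OF reg[OF i(1)] vis i(2)] i(1) by (simp add: Let_def)
next
  case ("2_1" D u v)
  then show ?case by (cases v) auto
qed auto

section \<open>Independence of events that depend on disjoint sets of coordinates\<close>

definition depends_on :: "(('a \<Rightarrow> 'b) \<Rightarrow> bool) \<Rightarrow> 'a set \<Rightarrow> bool" where
  "depends_on P A \<longleftrightarrow> (\<forall>f g. (\<forall>x\<in>A. f x = g x) \<longrightarrow> P f = P g)"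

lemma depends_onD: "depends_on P A \<Longrightarrow> (\<And>x. x \<in> A \<Longrightarrow> f x = g x) \<Longrightarrow> P f = P g"
  unfolding depends_on_def by blast

lemma depends_on_not: "depends_on P A \<Longrightarrow> depends_on (\<lambda>f. \<not> P f) A"
  unfolding depends_on_def by blast

lemma depends_on_conj:
  "depends_on P A \<Longrightarrow> depends_on Q B \<Longrightarrow> depends_on (\<lambda>f. P f \<and> Q f) (A \<union> B)"
  unfolding depends_on_def by (metis UnCI)

lemma depends_on_Ball:
  assumes "\<And>j. j \<in> J \<Longrightarrow> depends_on (P j) (A j)"
  shows "depends_on (\<lambda>f. \<forall>j\<in>J. P j f) (\<Union>j\<in>J. A j)"
  unfolding depends_on_def
proof (intro allI impI ball_cong refl)
  show "P j f = P j g" if "\<forall>x\<in>\<Union>j\<in>J. A j. f x = g x" "j \<in> J" for f g j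
    using that by (intro depends_onD[OF assms]) auto
qed

lemma prob_pair_pmf_Times:
  "measure_pmf.prob (pair_pmf M N) (A \<times> B) = measure_pmf.prob M A * measure_pmf.prob N B"
proof -
  \<comment> \<open>Restricting to the supports makes both factors countable, as the product rule
    requires.\<close>
  have "measure_pmf.prob (pair_pmf M N) (A \<times> B) =
      measure_pmf.prob (pair_pmf M N) ((A \<inter> set_pmf M) \<times> (B \<inter> set_pmf N))"
    by (subst measure_Int_set_pmf[symmetric]) (auto intro!: arg_cong2[where f = measure])
  also have "\<dots> = measure_pmf.prob M (A \<inter> set_pmf M) * measure_pmf.prob N (B \<inter> set_pmf N)"
    by (intro measure_pmf_prob_product) auto
  finally show ?thesis by (simp add: measure_Int_set_pmf)
qed

text \<open>The product measure is sampled in two independent parts, on \<open>S \<inter> A\<close>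
  and on \<open>S - A\<close>; \<open>P\<close> can be evaluated on the first part and
  \<open>Q\<close> on the second.\<close>

lemma prob_Pi_pmf_conj:
  assumes fin: "finite S" and P: "depends_on P A" and Q: "depends_on Q B" and disj: "A \<inter> B = {}"
  shows "measure_pmf.prob (Pi_pmf S d p) {f. P f \<and> Q f} =
    measure_pmf.prob (Pi_pmf S d p) {f. P f} * measure_pmf.prob (Pi_pmf S d p) {f. Q f}"
proof -
  let ?M = "Pi_pmf (S \<inter> A) d p" and ?N = "Pi_pmf (S - A) d p"
  let ?h = "\<lambda>(f, g) x. if x \<in> S \<inter> A then f x else g x"
  have M: "Pi_pmf S d p = map_pmf ?h (pair_pmf ?M ?N)"
    using Pi_pmf_union[of "S \<inter> A" "S - A" d p] fin by (simp add: Int_Diff_Un Int_Diff_disjoint)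
  have merge: "P (?h fg) = P (fst fg) \<and> Q (?h fg) = Q (snd fg)"
    if "fg \<in> set_pmf (pair_pmf ?M ?N)" for fg
  proof -
    \<comment> \<open>Defaults matter because \<open>A\<close> may stick out of \<open>S\<close>:
      there the merged function takes its value from the second part, and both parts equal
      \<open>d\<close>.\<close>
    have "fst fg x = d" if "x \<notin> S \<inter> A" for x
      using \<open>fg \<in> _\<close> set_Pi_pmf_subset[of "S \<inter> A" d p] fin that by auto
    moreover have "snd fg x = d" if "x \<notin> S - A" for x
      using \<open>fg \<in> _\<close> set_Pi_pmf_subset[of "S - A" d p] fin that by auto
    ultimately show ?thesis
      using disj by (intro conjI depends_onD[OF P] depends_onD[OF Q]) (auto simp: case_prod_unfold)
  qed
  \<comment> \<open>Stated for general events, so that the instances with one event trivially true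
    turn the two factors back into probabilities under the whole product.\<close>
  have *: "measure_pmf.prob (Pi_pmf S d p) {f. R1 f \<and> R2 f} =
      measure_pmf.prob ?M {f. R1 f} * measure_pmf.prob ?N {f. R2 f}"
    if "\<And>fg. fg \<in> set_pmf (pair_pmf ?M ?N) \<Longrightarrow> R1 (?h fg) = R1 (fst fg) \<and> R2 (?h fg) = R2 (snd fg)"
    for R1 R2
  proof -
    have "measure_pmf.prob (Pi_pmf S d p) {f. R1 f \<and> R2 f} =
        measure_pmf.prob (pair_pmf ?M ?N) {fg. R1 (?h fg) \<and> R2 (?h fg)}"
      unfolding M by (simp add: vimage_def)
    also have "\<dots> = measure_pmf.prob (pair_pmf ?M ?N) ({f. R1 f} \<times> {f. R2 f})"
      using that by (intro measure_pmf.finite_measure_eq_AE) (auto simp: AE_measure_pmf_iff)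
    also have "\<dots> = measure_pmf.prob ?M {f. R1 f} * measure_pmf.prob ?N {f. R2 f}"
      by (simp add: prob_pair_pmf_Times)
    finally show ?thesis .
  qed
  show ?thesis
    using *[of P Q] *[of P "\<lambda>_. True"] *[of "\<lambda>_. True" Q] merge by simp
qed

lemma prob_Pi_pmf_Ball:
  assumes "finite S" "finite J" "\<And>j. j \<in> J \<Longrightarrow> depends_on (P j) (A j)" "disjoint_family_on A J"
  shows "measure_pmf.prob (Pi_pmf S d p) {f. \<forall>j\<in>J. P j f} =
    (\<Prod>j\<in>J. measure_pmf.prob (Pi_pmf S d p) {f. P j f})"
  using assms(2-)
proof (induction J rule: finite_induct)
  case (insert j J)
  have "depends_on (\<lambda>f. \<forall>j\<in>J. P j f) (\<Union>j\<in>J. A j)"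
    using insert.prems(1) by (intro depends_on_Ball) auto
  moreover have "A j \<inter> (\<Union>j\<in>J. A j) = {}"
    using insert.prems(2) insert.hyps(2) by (fastforce simp: disjoint_family_on_def)
  moreover have "disjoint_family_on A J"
    using insert.prems(2) by (rule disjoint_family_on_mono[rotated]) auto
  ultimately show ?case
    using insert prob_Pi_pmf_conj[OF assms(1), of "P j" "A j"] by simp
qed simp

text \<open>All extensions of \<open>u\<close> are included, whether or not they are nodes of a
  tree. The sets of distinct siblings are then disjoint without reference to any tree.\<close>

definition subtree :: "nat list \<Rightarrow> nat list set" where
  "subtree u = range ((@) u)"

lemma subtree_child_subset: "subtree (u @ [i]) \<subseteq> subtree u"
  by (auto simp: subtree_def)

lemma subtree_root_notin: "u \<notin> subtree (u @ [i])"
  by (auto simp: subtree_def)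

lemma subtree_children_disjoint: "i \<noteq> j \<Longrightarrow> subtree (u @ [i]) \<inter> subtree (u @ [j]) = {}"
  by (auto simp: subtree_def)

lemma subtree_self: "u \<in> subtree u"
  by (auto simp: subtree_def image_iff intro: exI[of _ "[]"])

lemma depends_on_alive: "depends_on (\<lambda>D. alive D ks u) (subtree u)"
proof (induction ks arbitrary: u)
  case Nil
  then show ?case using subtree_self by (auto simp: depends_on_def)
next
  case (Cons k ks)
  show ?case unfolding depends_on_def
  proof (intro allI impI)
    fix f g :: "nat list \<Rightarrow> bool" assume "\<forall>x\<in>subtree u. f x = g x"
    then have "f u = g u" "alive f ks (u @ [i]) = alive g ks (u @ [i])" for i
      using subtree_self[of u] subtree_child_subset[of u i] by (auto intro!: depends_onD[OF Cons])
    then show "alive f (k # ks) u = alive g (k # ks) u" by simp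
  qed
qed

lemma depends_on_visible: "depends_on (\<lambda>D. visible D ks u v) (subtree u)"
proof (induction ks v arbitrary: u rule: address.induct)
  case (3 k ks i v)
  show ?case unfolding depends_on_def
  proof (intro allI impI)
    fix f g :: "nat list \<Rightarrow> bool" assume *: "\<forall>x\<in>subtree u. f x = g x"
    then have "f u = g u" using subtree_self by auto
    moreover have "alive f ks (u @ [j]) = alive g ks (u @ [j])" for j
      using * subtree_child_subset by (intro depends_onD[OF depends_on_alive]) auto
    moreover have "visible f ks (u @ [i]) v = visible g ks (u @ [i]) v"
      using * subtree_child_subset by (intro depends_onD[OF 3]) auto
    ultimately show "visible f (k # ks) u (i # v) = visible g (k # ks) u (i # v)" by simp
  qed
qed (use depends_on_alive in \<open>simp_all del: alive.simps\<close>)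

section \<open>Lower bounds from the supercritical branching process of survivors\<close>

locale supercritical =
  fixes c :: nat and q :: real and S :: "nat list set"
  assumes c: "c > 0" and q: "0 \<le> q" "q < real c / (real c + 1)" and finite_S: "finite S"
begin

text \<open>This equals \<open>c / (c + 1) - q\<close>, the slack in the hypothesis on
  \<open>q\<close>. It depends on \<open>c\<close> and \<open>q\<close> but not on \<open>S\<close>,
  which makes the final constant uniform over all trees.\<close>

definition \<gamma> :: real where "\<gamma> = 1 - q - 1 / (real c + 1)"

abbreviation "deletions \<equiv> Pi_pmf S False (\<lambda>_. bernoulli_pmf q)"

lemma q_less_1: "q < 1"
proof -
  have "real c / (real c + 1) < 1" by simp
  then show ?thesis using q by linarith
qed

lemma \<gamma>_bounds: "0 < \<gamma>" "\<gamma> \<le> 1 - q" "\<gamma> < 1"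
proof -
  have "real c / (real c + 1) = 1 - 1 / (real c + 1)" by (simp add: field_simps)
  moreover have "1 / (real c + 1) > 0" by simp
  ultimately show "0 < \<gamma>" "\<gamma> \<le> 1 - q" "\<gamma> < 1" using q unfolding \<gamma>_def by linarith+
qed

text \<open>Bernoulli's inequality gives \<open>(1 - \<gamma>) ^ m \<le> 1 / (1 + m \<gamma>)\<close>, and \<open>\<gamma>\<close> is the solution of
  \<open>(1 - q) (1 - 1 / (1 + m \<gamma>)) = \<gamma>\<close> for \<open>m = c + 1\<close>.\<close>

lemma \<gamma>_subsolution:
  assumes "k > c"
  shows "\<gamma> \<le> (1 - q) * (1 - (1 - \<gamma>) ^ k)"
proof -
  let ?m = "Suc c"
  have "1 + real ?m * \<gamma> \<le> (1 + \<gamma>) ^ ?m" using Bernoulli_inequality[of \<gamma> ?m] \<gamma>_bounds by simp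
  then have "(1 - \<gamma>) ^ ?m * (1 + real ?m * \<gamma>) \<le> (1 - \<gamma>) ^ ?m * (1 + \<gamma>) ^ ?m"
    using \<gamma>_bounds by (intro mult_left_mono) auto
  also have "\<dots> = (1 - \<gamma>\<^sup>2) ^ ?m"
    by (simp add: power_mult_distrib[symmetric] power2_eq_square algebra_simps del: power_Suc)
  also have "\<dots> \<le> 1" using \<gamma>_bounds by (intro power_le_one) (auto simp: power_le_one)
  finally have le: "(1 - \<gamma>) ^ ?m * (1 + real ?m * \<gamma>) \<le> 1" .
  have m: "1 + real ?m * \<gamma> = real ?m * (1 - q)" unfolding \<gamma>_def by (simp add: field_simps)
  have "real ?m * (1 - q) * (1 - \<gamma>) ^ ?m \<le> 1" using le unfolding m by (simp add: mult_ac)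
  then have "(1 - q) * (1 - \<gamma>) ^ ?m \<le> 1 / (real c + 1)"
    by (simp add: field_simps del: power_Suc)
  then have "\<gamma> \<le> (1 - q) * (1 - (1 - \<gamma>) ^ ?m)"
    unfolding \<gamma>_def[symmetric] by (simp add: algebra_simps \<gamma>_def del: power_Suc)
  also have "\<dots> \<le> (1 - q) * (1 - (1 - \<gamma>) ^ k)"
    using assms \<gamma>_bounds q_less_1 by (intro mult_left_mono diff_left_mono power_decreasing) auto
  finally show ?thesis .
qed

text \<open>An inequality, because addresses outside \<open>S\<close>, such as the root, are never
  deleted.\<close>

lemma prob_not_deleted: "1 - q \<le> measure_pmf.prob deletions {D. \<not> D u}"
proof -
  have "measure_pmf.prob deletions {D. \<not> D u} =
      measure_pmf.prob (map_pmf (\<lambda>D. D u) deletions) {False}"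
    by (simp add: vimage_def)
  also have "\<dots> = (if u \<in> S then 1 - q else 1)"
    using q q_less_1 by (simp add: Pi_pmf_component finite_S measure_pmf_single)
  finally show ?thesis using q by simp
qed

text \<open>If each of \<open>k > c\<close> children is independently alive with probability at
  least \<gamma>, the parent is alive with probability at least
  \<open>(1 - q) * (1 - (1 - \<gamma>) ^ k)\<close>, which is again at least \<gamma>. The bound
  therefore does not decay with the height.\<close>

lemma prob_alive:
  assumes "\<And>k. k \<in> set ks \<Longrightarrow> k > c"
  shows "\<gamma> \<le> measure_pmf.prob deletions {D. alive D ks u}"
  using assms
proof (induction ks arbitrary: u)
  case Nil
  then show ?case using prob_not_deleted[of u] \<gamma>_bounds by simp
next
  case (Cons k ks)
  let ?a = "\<lambda>i. measure_pmf.prob deletions {D. alive D ks (u @ [i])}"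
  have dep: "depends_on (\<lambda>D. \<not> alive D ks (u @ [i])) (subtree (u @ [i]))" for i
    by (intro depends_on_not depends_on_alive)
  have "measure_pmf.prob deletions {D. \<forall>i\<in>{..<k}. \<not> alive D ks (u @ [i])} =
      (\<Prod>i<k. measure_pmf.prob deletions {D. \<not> alive D ks (u @ [i])})"
    using subtree_children_disjoint
    by (intro prob_Pi_pmf_Ball[OF finite_S _ dep]) (auto simp: disjoint_family_on_def)
  also have "\<dots> = (\<Prod>i<k. 1 - ?a i)"
    by (intro prod.cong refl) (subst measure_pmf.prob_compl[symmetric], auto intro: arg_cong2[where f=measure])
  also have "\<dots> \<le> (\<Prod>i<k. 1 - \<gamma>)"
    using Cons by (intro prod_mono) auto
  finally have none: "measure_pmf.prob deletions {D. \<forall>i<k. \<not> alive D ks (u @ [i])} \<le> (1 - \<gamma>) ^ k"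
    by (simp add: Ball_def)
  have "measure_pmf.prob deletions {D. \<exists>i<k. alive D ks (u @ [i])} =
      1 - measure_pmf.prob deletions {D. \<forall>i<k. \<not> alive D ks (u @ [i])}"
    by (subst measure_pmf.prob_compl[symmetric]) (auto intro: arg_cong2[where f=measure])
  with none have some: "1 - (1 - \<gamma>) ^ k \<le> measure_pmf.prob deletions {D. \<exists>i<k. alive D ks (u @ [i])}"
    by simp
  have "depends_on (\<lambda>D. \<exists>i<k. alive D ks (u @ [i])) (\<Union>i<k. subtree (u @ [i]))"
    using depends_on_not[OF depends_on_Ball[OF dep, of "{..<k}"]] by (simp add: Bex_def)
  moreover have "depends_on (\<lambda>D. \<not> D u) {u}" by (auto simp: depends_on_def)
  ultimately have "measure_pmf.prob deletions {D. alive D (k # ks) u} =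
      measure_pmf.prob deletions {D. \<not> D u} *
      measure_pmf.prob deletions {D. \<exists>i<k. alive D ks (u @ [i])}"
    using subtree_root_notin unfolding alive.simps by (intro prob_Pi_pmf_conj[OF finite_S]) auto
  moreover have "(1 - q) * (1 - (1 - \<gamma>) ^ k) \<le> \<dots>"
    using some prob_not_deleted[of u] q_less_1 \<gamma>_bounds
    by (intro mult_mono) (auto simp: power_le_one)
  ultimately show ?case using \<gamma>_subsolution[of k] Cons.prems by simp
qed

text \<open>Each level with count \<open>k\<close> on the path costs at most \<open>k\<close>
  factors \<gamma>: one for the undeleted path node, since \<open>\<gamma> \<le> 1 - q\<close>, and
  \<open>k - 1\<close> for its child's siblings. The end point costs one more, hence the
  \<open>Suc\<close>.\<close>

lemma prob_visible:
  assumes "\<And>k. k \<in> set ks \<Longrightarrow> k > c" "address ks v"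
  shows "\<gamma> ^ Suc (sum_list ks) \<le> measure_pmf.prob deletions {D. visible D ks u v}"
  using assms
proof (induction ks v arbitrary: u rule: address.induct)
  case (1 ks)
  have "\<gamma> ^ Suc (sum_list ks) \<le> \<gamma>"
    using \<gamma>_bounds power_le_one[of \<gamma> "sum_list ks"] by (simp add: mult_left_le)
  then show ?case using prob_alive[of ks u] 1 by simp
next
  case (3 k ks i v)
  let ?J = "{..<k} - {i}"
  let ?P = "measure_pmf.prob deletions"
  have sibl: "?P {D. \<forall>j\<in>?J. alive D ks (u @ [j])} = (\<Prod>j\<in>?J. ?P {D. alive D ks (u @ [j])})"
    using subtree_children_disjoint
    by (intro prob_Pi_pmf_Ball[OF finite_S _ depends_on_alive]) (auto simp: disjoint_family_on_def)
  have "(\<Prod>j\<in>?J. \<gamma>) \<le> (\<Prod>j\<in>?J. ?P {D. alive D ks (u @ [j])})"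
    using 3 \<gamma>_bounds prob_alive by (intro prod_mono) auto
  then have sib: "\<gamma> ^ (k - 1) \<le> ?P {D. \<forall>j\<in>?J. alive D ks (u @ [j])}"
    using 3 unfolding sibl by simp
  have rec: "\<gamma> ^ Suc (sum_list ks) \<le> ?P {D. visible D ks (u @ [i]) v}"
    using 3 by auto
  have dep: "depends_on (\<lambda>D. \<forall>j\<in>?J. alive D ks (u @ [j])) (\<Union>j\<in>?J. subtree (u @ [j]))"
    by (intro depends_on_Ball depends_on_alive)
  have "depends_on (\<lambda>D. (\<forall>j\<in>?J. alive D ks (u @ [j])) \<and> visible D ks (u @ [i]) v)
      ((\<Union>j\<in>?J. subtree (u @ [j])) \<union> subtree (u @ [i]))"
    by (intro depends_on_conj dep depends_on_visible)
  moreover have "depends_on (\<lambda>D. \<not> D u) {u}" by (auto simp: depends_on_def)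
  ultimately have "?P {D. visible D (k # ks) u (i # v)} = ?P {D. \<not> D u} *
      ?P {D. (\<forall>j\<in>?J. alive D ks (u @ [j])) \<and> visible D ks (u @ [i]) v}"
    using subtree_root_notin unfolding visible.simps by (intro prob_Pi_pmf_conj[OF finite_S]) auto
  also have "?P {D. (\<forall>j\<in>?J. alive D ks (u @ [j])) \<and> visible D ks (u @ [i]) v} =
      ?P {D. \<forall>j\<in>?J. alive D ks (u @ [j])} * ?P {D. visible D ks (u @ [i]) v}"
    using subtree_children_disjoint
    by (intro prob_Pi_pmf_conj[OF finite_S dep depends_on_visible]) auto
  finally have "\<gamma> * (\<gamma> ^ (k - 1) * \<gamma> ^ Suc (sum_list ks)) \<le> ?P {D. visible D (k # ks) u (i # v)}"
    using sib rec prob_not_deleted[of u] \<gamma>_bounds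
    by (simp only:) (intro mult_mono mult_nonneg_nonneg, auto)
  \<comment> \<open>Here \<open>i < k\<close> gives \<open>k \<ge> 1\<close>, so the truncated
    difference \<open>k - 1\<close> is harmless.\<close>
  moreover have "\<gamma> * (\<gamma> ^ (k - 1) * \<gamma> ^ Suc (sum_list ks)) = \<gamma> ^ Suc (sum_list (k # ks))"
    using 3 by (simp add: power_add[symmetric] power_Suc[symmetric] del: power_Suc)
  ultimately show ?case by (simp only:)
qed auto

end

section \<open>The estimator and its failure probability\<close>

lemma prob_replicate_pmf_all:
  "measure_pmf.prob (replicate_pmf T p) {xs. \<forall>x\<in>set xs. x \<in> A} = measure_pmf.prob p A ^ T"
proof (induction T)
  case (Suc T)
  have "replicate_pmf (Suc T) p = map_pmf (\<lambda>(x, xs). x # xs) (pair_pmf p (replicate_pmf T p))"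
    by (simp add: pair_pmf_def map_bind_pmf)
  then have "measure_pmf.prob (replicate_pmf (Suc T) p) {xs. \<forall>x\<in>set xs. x \<in> A} =
      measure_pmf.prob (pair_pmf p (replicate_pmf T p)) (A \<times> {xs. \<forall>x\<in>set xs. x \<in> A})"
    by (auto simp del: replicate_pmf.simps intro!: arg_cong2[where f=measure])
  then show ?case by (simp add: prob_pair_pmf_Times Suc del: replicate_pmf.simps)
qed simp

text \<open>Only the topology and the traces enter, so one function serves all trees and can be
  fixed before \<open>n\<close>. Consistency is purely combinatorial: some deletion pattern explains
  each trace.\<close>

definition consistent_tree :: "unit rtree \<Rightarrow> 'a rtree list \<Rightarrow> 'a rtree" where
  "consistent_tree U traces =
     (SOME Y. tree_topology Y = U \<and> (\<forall>t\<in>set traces. \<exists>D. t = ted_delete D Y))"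

text \<open>The true tree is consistent. Any consistent \<open>Y\<close> has the same shape, and
  soundness applied to the same trace, once as a contraction of \<open>X\<close> and once of
  \<open>Y\<close>, forces equal labels at every address that is read.\<close>

lemma consistent_tree_eq:
  assumes reg: "regular_forest ks (kids X)"
    and traces: "\<forall>t\<in>set traces. \<exists>D. t = ted_delete D X"
    and read: "\<And>v. v \<noteq> [] \<Longrightarrow> address ks v \<Longrightarrow> \<exists>t\<in>set traces. read_label ks v (kids t) \<noteq> None"
  shows "consistent_tree (tree_topology X) traces = X"
  unfolding consistent_tree_def
proof (rule some_equality)
  show "tree_topology X = tree_topology X \<and> (\<forall>t\<in>set traces. \<exists>D. t = ted_delete D X)"
    using traces by simp
next
  fix Y assume Y: "tree_topology Y = tree_topology X \<and> (\<forall>t\<in>set traces. \<exists>D. t = ted_delete D Y)"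
  have "map (map_node (\<lambda>_. ())) (kids Y) = map (map_node (\<lambda>_. ())) (kids X)"
    using Y by (cases X; cases Y) (simp add: tree_topology_def)
  then have regY: "regular_forest ks (kids Y)"
    using reg by (metis regular_forest_map)
  have "kids Y = kids X"
  proof (rule regular_forest_eqI[OF regY reg])
    fix v assume "v \<noteq> []" "address ks v"
    from read[OF this] obtain t a where t: "t \<in> set traces" "read_label ks v (kids t) = Some a"
      by auto
    obtain D D' where D: "t = ted_delete D X" and D': "t = ted_delete D' Y"
      using Y traces t(1) by blast
    have "kids t = contract_kids D [] 0 (kids X)" by (simp add: D ted_delete_def)
    moreover have "kids t = contract_kids D' [] 0 (kids Y)" by (simp add: D' ted_delete_def)
    ultimately show "label_at (kids Y) v = label_at (kids X) v"
      using t(2) read_label_sound[OF reg, of v D "[]" a] read_label_sound[OF regY, of v D' "[]" a]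
      by simp
  qed
  then show "Y = X" by (simp add: rtree.expand)
qed

text \<open>An error requires an address that none of the \<open>T\<close> independent traces
  reveals; a union bound over the addresses gives the factor \<open>card (nodes X)\<close>.\<close>

lemma prob_consistent_tree_ne:
  assumes "c > 0" "0 \<le> q" "q < real c / (real c + 1)"
    and reg: "regular_forest ks (kids X)" and ks: "\<And>k. k \<in> set ks \<Longrightarrow> k > c"
  shows "measure_pmf.prob (ted_traces q T X) {traces. consistent_tree (tree_topology X) traces \<noteq> X}
    \<le> real (card (nodes X)) * (1 - supercritical.\<gamma> c q ^ Suc (sum_list ks)) ^ T"
proof -
  interpret supercritical c q "nodes X - {[]}"
    using assms finite_nodes by unfold_locales auto
  define B where "B v = {t. read_label ks v (kids t) = (None :: 'a option)}" for v
  let ?V = "nodes X - {[]}"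
  let ?M = "ted_traces q T X"
  let ?r = "1 - \<gamma> ^ Suc (sum_list ks)"
  have addr: "address ks v \<longleftrightarrow> v \<in> nodes X" for v
    using children_at_iff_address[OF reg] by (simp add: nodes_def)
  have B: "measure_pmf.prob (ted_trace q X) (B v) \<le> ?r" if "v \<in> ?V" for v
  proof -
    have "\<gamma> ^ Suc (sum_list ks) \<le> measure_pmf.prob deletions {D. visible D ks [] v}"
      using that addr by (intro prob_visible ks) auto
    also have "\<dots> \<le> measure_pmf.prob deletions {D. ted_delete D X \<notin> B v}"
      using visible_imp_read_label[OF reg] that addr
      by (intro measure_pmf.finite_measure_mono) (auto simp: B_def ted_delete_def)
    also have "\<dots> = measure_pmf.prob (ted_trace q X) (UNIV - B v)"
      unfolding ted_trace_def by (auto intro: arg_cong2[where f = measure])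
    also have "\<dots> = 1 - measure_pmf.prob (ted_trace q X) (B v)"
      using measure_pmf.prob_compl[of "B v" "ted_trace q X"] by simp
    finally show ?thesis by simp
  qed
  \<comment> \<open>Intersecting with the support ensures that every trace really is a contraction
    of \<open>X\<close>.\<close>
  have "{traces. consistent_tree (tree_topology X) traces \<noteq> X} \<inter> set_pmf ?M \<subseteq>
      (\<Union>v\<in>?V. {traces. \<forall>t\<in>set traces. t \<in> B v})"
  proof
    fix ts assume ts: "ts \<in> {traces. consistent_tree (tree_topology X) traces \<noteq> X} \<inter> set_pmf ?M"
    then have "\<forall>t\<in>set ts. \<exists>D. t = ted_delete D X"
      by (auto simp: ted_traces_def ted_trace_def set_replicate_pmf)
    then show "ts \<in> (\<Union>v\<in>?V. {traces. \<forall>t\<in>set traces. t \<in> B v})"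
      using consistent_tree_eq[OF reg, of ts] ts addr unfolding B_def by blast
  qed
  then have "measure_pmf.prob ?M ({traces. consistent_tree (tree_topology X) traces \<noteq> X} \<inter> set_pmf ?M)
      \<le> measure_pmf.prob ?M (\<Union>v\<in>?V. {traces. \<forall>t\<in>set traces. t \<in> B v})"
    by (intro measure_pmf.finite_measure_mono) auto
  also have "\<dots> \<le> (\<Sum>v\<in>?V. measure_pmf.prob ?M {traces. \<forall>t\<in>set traces. t \<in> B v})"
    using finite_nodes by (intro measure_pmf.finite_measure_subadditive_finite) auto
  also have "\<dots> \<le> (\<Sum>v\<in>?V. ?r ^ T)"
    using B by (intro sum_mono) (simp add: ted_traces_def prob_replicate_pmf_all power_mono)
  also have "\<dots> \<le> real (card (nodes X)) * ?r ^ T"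
  proof -
    have "0 \<le> ?r" using \<gamma>_bounds power_le_one[of \<gamma> "Suc (sum_list ks)"] by simp
    then show ?thesis
      using finite_nodes[of X] by (simp add: mult_right_mono card_mono del: power_Suc)
  qed
  finally show ?thesis by (simp add: measure_Int_set_pmf)
qed

section \<open>Depth bounds and the number of traces\<close>

lemma level_regular_imp_regular_forest:
  assumes "level_regular X k"
  shows "regular_forest (map k [0..<last_level X]) (kids X)"
proof (rule regular_forest_of_levels)
  show "length us = k (0 + length v)" if "children_at (kids X) v = Some us" for v us
  proof -
    have "v \<in> nodes X" using that by (simp add: nodes_def)
    then show ?thesis using assms that by (auto simp: level_regular_def num_children_def)
  qed
  show "0 + length v \<le> last_level X" if "children_at (kids X) v \<noteq> None" for v
    using that finite_nodes[of X] by (auto simp: last_level_def nodes_def intro!: Max_ge)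
qed

lemma last_level_pos:
  assumes "card (nodes X) \<ge> 2"
  shows "last_level X > 0"
proof -
  have "\<not> nodes X \<subseteq> {[]}" using assms card_mono[of "{[]}" "nodes X"] by auto
  then obtain v where v: "v \<in> nodes X" "v \<noteq> []" by auto
  have "length v \<le> last_level X"
    unfolding last_level_def using v finite_nodes by (intro Max_ge) auto
  then show ?thesis using v(2) by (cases v) auto
qed

lemma k_min_power_last_level_le:
  assumes "level_regular X k" "last_level X > 0"
  shows "k_min X k ^ last_level X \<le> card (nodes X)"
proof -
  let ?d = "last_level X"
  have "k_min X k ^ card {0..<?d} \<le> (\<Prod>i\<in>{0..<?d}. k i)"
    unfolding prod_constant[symmetric] by (intro prod_mono) (auto simp: k_min_def intro!: Min_le)
  then have "k_min X k ^ ?d \<le> prod_list (map k [0..<?d])"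
    by (simp add: prod.distinct_set_conv_list[symmetric])
  also have "\<dots> \<le> card (nodes X)"
    unfolding nodes_def by (rule card_children_at_ge[OF level_regular_imp_regular_forest[OF assms(1)]])
  finally show ?thesis .
qed

theorem theorem3:
  fixes c :: nat and q :: real
  assumes "c > 0" and "0 \<le> q" and "q < real c / (real c + 1)"
  shows "\<exists>(C :: real) (estimator :: unit rtree \<Rightarrow> bool rtree list \<Rightarrow> bool rtree).
    \<forall>\<epsilon>>0. \<forall>\<^sub>F n in sequentially.
      \<forall>(X :: bool rtree) (k :: nat \<Rightarrow> nat).
        card (nodes X) = n \<and> level_regular X k \<and> k_min X k > c \<longrightarrow>
        measure_pmf.prob
          (ted_traces q (nat \<lceil>exp (C * real (k_max X k) * log (real (k_min X k)) (real n))\<rceil>) X)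
          {traces. estimator (tree_topology X) traces = X} \<ge> 1 - \<epsilon>"
proof -
  define g where "g = supercritical.\<gamma> c q"
  \<comment> \<open>Since \<gamma> is independent of \<open>S\<close>, the empty set suffices to
    obtain its bounds.\<close>
  have "supercritical c q {}" using assms by unfold_locales auto
  then have g: "0 < g" "g < 1" unfolding g_def by (auto dest: supercritical.\<gamma>_bounds)
  define a where "a = - ln g"
  have a: "a > 0" "g = exp (- a)" unfolding a_def using g by auto
  \<comment> \<open>With \<open>L\<close> the exponent without \<open>C\<close>, the part
    \<open>2 * a\<close> compensates a reading probability of at least
    \<open>exp (- (2 * a * L))\<close>, and the remaining \<open>2\<close> yields
    \<open>exp (2 * L) \<ge> n\<^sup>2\<close>.\<close>
  define C where "C = 2 * a + 2"
  \<comment> \<open>An error of \<open>1 / n\<close>, uniform in \<open>X\<close> and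
    \<open>k\<close>. With \<open>n \<ge> 2\<close> there is a level below the root, so
    \<open>k_min\<close> is a minimum over a nonempty set.\<close>
  have bound: "1 - 1 / real n \<le> measure_pmf.prob
      (ted_traces q (nat \<lceil>exp (C * real (k_max X k) * log (real (k_min X k)) (real n))\<rceil>) X)
      {traces. consistent_tree (tree_topology X) traces = X}"
    if n: "n \<ge> 2" and X: "card (nodes X) = n" "level_regular X k" "k_min X k > c"
    for n k and X :: "bool rtree"
  proof -
    define d where "d = last_level X"
    define L where "L = real (k_max X k) * log (real (k_min X k)) (real n)"
    define T where "T = nat \<lceil>exp (C * L)\<rceil>"
    define p where "p = g ^ Suc (sum_list (map k [0..<d]))"
    let ?M = "ted_traces q T X"
    have d: "d > 0" using last_level_pos[of X] n X(1) by (simp add: d_def)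
    have k_ge: "k_min X k \<le> k i" if "i < d" for i
      using that by (auto simp: k_min_def d_def intro!: Min_le)
    have k_le: "k i \<le> k_max X k" if "i < d" for i
      using that by (auto simp: k_max_def d_def intro!: Max_ge)
    have kmin: "2 \<le> k_min X k" using X(3) assms(1) by simp
    have kmax: "k_min X k \<le> k_max X k" using k_ge[OF d] k_le[OF d] by simp
    have "real (k_min X k) ^ d \<le> real n"
      using k_min_power_last_level_le[OF X(2)] d X(1)
      by (metis d_def of_nat_le_iff of_nat_power)
    then have "real d \<le> log (real (k_min X k)) (real n)"
      using kmin n by (subst le_log_iff) (auto simp: powr_realpow)
    then have dL: "real (k_max X k) * real d \<le> L" unfolding L_def by (intro mult_left_mono) auto
    \<comment> \<open>Because \<open>ln k_min \<le> k_min \<le> k_max\<close>, the quotient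
      \<open>k_max / ln k_min\<close> is at least 1.\<close>
    have lnL: "ln (real n) \<le> L"
    proof -
      have "ln (real (k_min X k)) \<le> real (k_min X k)"
        using ln_le_minus_one[of "real (k_min X k)"] kmin by simp
      then have "ln (real (k_min X k)) \<le> real (k_max X k)" using kmax by linarith
      then have "ln (real n) * ln (real (k_min X k)) \<le> ln (real n) * real (k_max X k)"
        using n by (intro mult_left_mono) auto
      then show ?thesis unfolding L_def log_def using kmin by (simp add: field_simps)
    qed
    have "sum_list (map k [0..<d]) \<le> d * k_max X k"
      using sum_bounded_above[of "{0..<d}" k "k_max X k"] k_le
      by (simp add: sum.distinct_set_conv_list[symmetric])
    then have "real (sum_list (map k [0..<d])) \<le> real (d * k_max X k)" by linarith
    \<comment> \<open>This absorbs the \<open>Suc\<close> in the exponent of \<open>p\<close> and is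
      the source of the factor 2 in \<open>2 * L\<close>.\<close>
    moreover have "1 \<le> real (k_max X k) * real d"
    proof -
      have "1 \<le> k_max X k * d" using d kmax kmin by simp
      then show ?thesis by (metis of_nat_1 of_nat_le_iff of_nat_mult)
    qed
    ultimately have "real (Suc (sum_list (map k [0..<d]))) \<le> 2 * L"
      using dL by (simp add: mult.commute)
    then have "real (Suc (sum_list (map k [0..<d]))) * a \<le> 2 * L * a"
      using a by (intro mult_right_mono) auto
    moreover have "p = exp (- (real (Suc (sum_list (map k [0..<d]))) * a))"
      unfolding p_def a(2) by (simp only: exp_of_nat_mult[symmetric] mult_minus_right)
    ultimately have p: "exp (- (2 * a * L)) \<le> p" by (simp add: mult_ac)
    have p1: "0 < p" "p \<le> 1" unfolding p_def using g by (auto intro!: power_le_one simp del: power_Suc)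
    \<comment> \<open>The target is \<open>p * T \<ge> n\<^sup>2\<close>: then
      \<open>(1 - p) ^ T \<le> exp (- n\<^sup>2) \<le> 1 / n\<^sup>2\<close>, which beats the factor
      \<open>n\<close> of the union bound.\<close>
    have "real n ^ 2 = exp (2 * ln (real n))" using n by (simp add: exp_double)
    also have "\<dots> \<le> exp (2 * L)" using lnL by simp
    also have "\<dots> = exp (- (2 * a * L)) * exp (C * L)"
      unfolding C_def by (simp add: exp_add[symmetric] algebra_simps)
    also have "\<dots> \<le> p * real T"
      unfolding T_def using p p1 by (intro mult_mono real_nat_ceiling_ge) auto
    finally have pT: "real n ^ 2 \<le> p * real T" .
    have "(1 - p) ^ T \<le> exp (- p) ^ T"
      using exp_ge_add_one_self[of "- p"] p1 by (intro power_mono) auto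
    also have "\<dots> = exp (- (p * real T))" by (simp add: exp_of_nat_mult[symmetric] mult.commute)
    also have "\<dots> \<le> exp (- (real n ^ 2))" using pT by simp
    also have "\<dots> \<le> 1 / real n ^ 2"
    proof -
      have "real n ^ 2 \<le> exp (real n ^ 2)" using exp_ge_add_one_self[of "real n ^ 2"] by linarith
      then show ?thesis using n by (simp add: exp_minus field_simps)
    qed
    finally have "real n * (1 - p) ^ T \<le> real n * (1 / real n ^ 2)" by (intro mult_left_mono) auto
    also have "\<dots> = 1 / real n" using n by (simp add: power2_eq_square)
    finally have small: "real n * (1 - p) ^ T \<le> 1 / real n" .
    have "measure_pmf.prob ?M {traces. consistent_tree (tree_topology X) traces \<noteq> X}
        \<le> real n * (1 - p) ^ T"
      unfolding X(1)[symmetric] p_def g_def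
    proof (rule prob_consistent_tree_ne[OF assms])
      show "regular_forest (map k [0..<d]) (kids X)"
        unfolding d_def by (rule level_regular_imp_regular_forest[OF X(2)])
      show "c < j" if "j \<in> set (map k [0..<d])" for j
        using that k_ge X(3) by (auto intro: less_le_trans)
    qed
    moreover have "measure_pmf.prob ?M {traces. consistent_tree (tree_topology X) traces \<noteq> X} =
        1 - measure_pmf.prob ?M {traces. consistent_tree (tree_topology X) traces = X}"
      by (subst measure_pmf.prob_compl[symmetric]) (auto intro: arg_cong2[where f = measure])
    ultimately show ?thesis using small unfolding T_def L_def by (simp add: mult.assoc)
  qed
  show ?thesis
  proof (intro exI allI impI)
    fix \<epsilon> :: real assume "\<epsilon> > 0"
    then have "\<forall>\<^sub>F n in sequentially. 1 / real n < \<epsilon>"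
      by (intro order_tendstoD(2)[OF lim_1_over_n])
    then show "\<forall>\<^sub>F n in sequentially.
      \<forall>(X :: bool rtree) (k :: nat \<Rightarrow> nat).
        card (nodes X) = n \<and> level_regular X k \<and> k_min X k > c \<longrightarrow>
        measure_pmf.prob
          (ted_traces q (nat \<lceil>exp (C * real (k_max X k) * log (real (k_min X k)) (real n))\<rceil>) X)
          {traces. consistent_tree (tree_topology X) traces = X} \<ge> 1 - \<epsilon>"
      using eventually_ge_at_top[of 2]
    proof eventually_elim
      case (elim n)
      show ?case
      proof (intro allI impI)
        fix X :: "bool rtree" and k
        assume "card (nodes X) = n \<and> level_regular X k \<and> k_min X k > c"
        then show "1 - \<epsilon> \<le> measure_pmf.prob
            (ted_traces q (nat \<lceil>exp (C * real (k_max X k) * log (real (k_min X k)) (real n))\<rceil>) X)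
            {traces. consistent_tree (tree_topology X) traces = X}"
          using bound[of n X k] elim by linarith
      qed
    qed
  qed
qed

end
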